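(* Let $\mathbb{F}$ be a field and $E=\mathbb{F}^n$. Every $q$-$g$-matroid $(E,\mathcal{F})$ is a weak $q$-$g$-matroid.
   Context: $E=\mathbb{F}^n$ is a finite-dimensional vector space over a field $\mathbb{F}$. A $q$-matroid on $E$ is a pair $M=(E,r)$ with $r$ an integer-valued function on the subspaces of $E$ such that (R1) $0\le r(A)\le\dim A$ for every subspace $A$; (R2) $r(A)\le r(B)$ whenever $A\subseteq B$; (R3) $r(A+B)+r(A\cap B)\le r(A)+r(B)$ for all subspaces $A,B$. A subspace $A$ is independent if $r(A)=\dim A$; a basis is an inclusion-maximal independent subspace; $A$ is spanning if $r(A)=r(E)$; $A$ is a flat if $r(A+x)>r(A)$ for every $1$-dimensional subspace $x\not\subseteq A$. For $q$-matroids $M_1,M_2$ on the same ground space $E$, the identity $Id:M_1\to M_2$ is a strong map if every flat of $M_2$ is a flat of $M_1$. A $q$-$g$-matroid is a pair $(E,\mathcal{F})$ for which there exist $q$-matroids $M_1,M_2$ on $E$ such that $Id:M_1\to M_2$ is a strong map and $\mathcal{F}$ is the set of all subspaces of $E$ that are independent in $M_1$ and spanning in $M_2$. A weak $q$-$g$-matroid is a pair $(E,\mathcal{F})$ for which there exist $q$-matroids $M_1,M_2$ on $E$ such that every basis of $M_2$ is contained in a basis of $M_1$, every basis of $M_1$ contains a basis of $M_2$, and $\mathcal{F}$ is the set of all subspaces $F\subseteq E$ for which there exist a basis $B_2$ of $M_2$ and a basis $B_1$ of $M_1$ with $B_2\subseteq F\subseteq B_1$. *)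

theory Defs
  imports Main "HOL.Vector_Spaces"
begin

text \<open>
  The ground space of a $q$-matroid is the whole vector space, that is, the universe of the
  type of vectors, so that a $q$-matroid is given by its rank function alone, and a pair of
  the ground space and a family of subspaces by that family alone.  Rank functions are total on
  sets of vectors; only their values on subspaces are constrained or used.  The space
  \<open>'a ^ 'n\<close> of vectors over a field, from \<open>HOL-Analysis\<close>, is the instance given there by
  the interpretation \<open>vec\<close> of \<open>finite_dimensional_vector_space\<close>.
  The theories of real vector spaces are not imported here: they interpret \<open>vector_space\<close>
  with an optional prefix, and the constants below would be shadowed by their real instances.
\<close>

context vector_space
begin

definition subspace_sum :: "'b set \<Rightarrow> 'b set \<Rightarrow> 'b set" where
  "subspace_sum A B = {x + y | x y. x \<in> A \<and> y \<in> B}"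

definition q_matroid :: "('b set \<Rightarrow> int) \<Rightarrow> bool" where
  "q_matroid r \<longleftrightarrow>
     (\<forall>A. subspace A \<longrightarrow> 0 \<le> r A \<and> r A \<le> int (dim A)) \<and>
     (\<forall>A B. subspace A \<longrightarrow> subspace B \<longrightarrow> A \<subseteq> B \<longrightarrow> r A \<le> r B) \<and>
     (\<forall>A B. subspace A \<longrightarrow> subspace B \<longrightarrow>
        r (subspace_sum A B) + r (A \<inter> B) \<le> r A + r B)"

definition q_independent :: "('b set \<Rightarrow> int) \<Rightarrow> 'b set \<Rightarrow> bool" where
  "q_independent r A \<longleftrightarrow> subspace A \<and> r A = int (dim A)"

definition q_basis :: "('b set \<Rightarrow> int) \<Rightarrow> 'b set \<Rightarrow> bool" where
  "q_basis r B \<longleftrightarrow>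
     q_independent r B \<and> (\<forall>A. q_independent r A \<longrightarrow> B \<subseteq> A \<longrightarrow> A = B)"

definition q_spanning :: "('b set \<Rightarrow> int) \<Rightarrow> 'b set \<Rightarrow> bool" where
  "q_spanning r A \<longleftrightarrow> subspace A \<and> r A = r UNIV"

definition q_flat :: "('b set \<Rightarrow> int) \<Rightarrow> 'b set \<Rightarrow> bool" where
  "q_flat r A \<longleftrightarrow> subspace A \<and>
     (\<forall>X. subspace X \<longrightarrow> dim X = 1 \<longrightarrow> \<not> X \<subseteq> A \<longrightarrow> r A < r (subspace_sum A X))"

definition id_strong_map :: "('b set \<Rightarrow> int) \<Rightarrow> ('b set \<Rightarrow> int) \<Rightarrow> bool" where
  "id_strong_map r1 r2 \<longleftrightarrow> (\<forall>A. q_flat r2 A \<longrightarrow> q_flat r1 A)"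

definition q_g_matroid :: "'b set set \<Rightarrow> bool" where
  "q_g_matroid \<F> \<longleftrightarrow> (\<exists>r1 r2. q_matroid r1 \<and> q_matroid r2 \<and> id_strong_map r1 r2 \<and>
     \<F> = {F. q_independent r1 F \<and> q_spanning r2 F})"

definition weak_q_g_matroid :: "'b set set \<Rightarrow> bool" where
  "weak_q_g_matroid \<F> \<longleftrightarrow> (\<exists>r1 r2. q_matroid r1 \<and> q_matroid r2 \<and>
     (\<forall>B2. q_basis r2 B2 \<longrightarrow> (\<exists>B1. q_basis r1 B1 \<and> B2 \<subseteq> B1)) \<and>
     (\<forall>B1. q_basis r1 B1 \<longrightarrow> (\<exists>B2. q_basis r2 B2 \<and> B2 \<subseteq> B1)) \<and>
     \<F> = {F. subspace F \<and> (\<exists>B2 B1. q_basis r2 B2 \<and> q_basis r1 B1 \<and> B2 \<subseteq> F \<and> F \<subseteq> B1)})"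

end

end

theory Submission
  imports Defs
begin

text \<open>
  The two \<open>q\<close>-matroids of the strong map themselves witness the weak \<open>q\<close>-\<open>g\<close>-matroid.  A flat of
  \<open>M2\<close> is a flat of \<open>M1\<close>, so whenever adjoining a vector to a subspace does not raise the rank
  in \<open>M1\<close>, it does not raise the rank in \<open>M2\<close> either.  Consequently independence in \<open>M2\<close> implies
  independence in \<open>M1\<close>, and spanning in \<open>M1\<close> implies spanning in \<open>M2\<close>.  The rest is that
  independent subspaces extend to bases, spanning subspaces contain bases, and bases span.
\<close>

context vector_space
begin

section \<open>Sums of subspaces and the rank axioms\<close>

lemma subspace_sum_eq_span: "subspace A \<Longrightarrow> subspace B \<Longrightarrow> subspace_sum A B = span (A \<union> B)"
  unfolding subspace_sum_def by (auto simp: span_Un span_eq_iff[THEN iffD2])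

lemma subspace_sum_span_singleton: "subspace A \<Longrightarrow> subspace_sum A (span {x}) = span (insert x A)"
  by (simp add: subspace_sum_eq_span span_Un[of A "span {x}"] span_Un[of A "{x}", simplified] span_span)

lemma q_matroid_rank_nonneg: "q_matroid r \<Longrightarrow> subspace A \<Longrightarrow> 0 \<le> r A"
  and q_matroid_rank_le_dim: "q_matroid r \<Longrightarrow> subspace A \<Longrightarrow> r A \<le> int (dim A)"
  by (auto simp: q_matroid_def)

lemma q_matroid_rank_mono:
  "q_matroid r \<Longrightarrow> A \<subseteq> B \<Longrightarrow> subspace A \<Longrightarrow> subspace B \<Longrightarrow> r A \<le> r B"
  by (auto simp: q_matroid_def)

lemma q_matroid_rank_submodular:
  assumes "q_matroid r" "subspace A" "subspace B"
  shows "r (span (A \<union> B)) + r (A \<inter> B) \<le> r A + r B"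
  using assms unfolding q_matroid_def by (metis subspace_sum_eq_span)

lemma q_independent_subspace: "q_independent r A \<Longrightarrow> subspace A"
  by (simp add: q_independent_def)

lemma q_basis_independent: "q_basis r A \<Longrightarrow> q_independent r A"
  by (simp add: q_basis_def)

text \<open>Submodularity for \<open>T\<close> and \<open>span (insert x A)\<close>: their sum is
  \<open>span (insert x T)\<close> and their intersection contains \<open>A\<close>, so adding
  \<open>x\<close> to \<open>T\<close> gains no more rank than adding it to \<open>A\<close>, namely
  nothing. For \<open>x\<close> outside the flat \<open>T\<close> this is a contradiction.\<close>

lemma q_flat_mem:
  assumes r: "q_matroid r" and T: "q_flat r T" and A: "subspace A" "A \<subseteq> T"
    and x: "r (span (insert x A)) = r A"
  shows "x \<in> T"
proof (rule ccontr)
  assume xT: "x \<notin> T"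
  have sT: "subspace T"
    using T by (simp add: q_flat_def)
  have "x \<noteq> 0"
    using xT sT subspace_0 by blast
  then have "dim (span {x}) = 1"
    by (simp add: dim_eq_card_independent)
  moreover have "\<not> span {x} \<subseteq> T"
    using xT span_base by blast
  ultimately have "r T < r (subspace_sum T (span {x}))"
    using T by (simp add: q_flat_def)
  then have less: "r T < r (span (insert x T))"
    by (simp add: subspace_sum_span_singleton sT)
  have "insert x A \<subseteq> span (insert x T)"
    using A(2) span_superset[of "insert x T"] by blast
  then have "span (insert x A) \<subseteq> span (insert x T)"
    by (simp add: span_minimal)
  then have "span (T \<union> span (insert x A)) \<subseteq> span (insert x T)"
    using span_superset[of "insert x T"] by (intro span_minimal) auto
  moreover have "span (insert x T) \<subseteq> span (T \<union> span (insert x A))"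
    using span_superset[of "insert x A"] by (intro span_mono) auto
  ultimately have "r (span (insert x T)) + r (T \<inter> span (insert x A)) \<le> r T + r A"
    using q_matroid_rank_submodular[OF r sT, of "span (insert x A)"] x by simp
  moreover have "r A \<le> r (T \<inter> span (insert x A))"
    using A(2) span_superset[of "insert x A"]
    by (intro q_matroid_rank_mono[OF r]) (auto intro: A(1) subspace_inter sT)
  ultimately show False
    using less by simp
qed

end

section \<open>Maximal subspaces and closures\<close>

context finite_dimensional_vector_space
begin

lemma maximal_subspace_exists:
  assumes P: "P A" and sub: "\<And>S. P S \<Longrightarrow> subspace S"
  obtains T where "P T" "A \<subseteq> T" "\<And>U. P U \<Longrightarrow> T \<subseteq> U \<Longrightarrow> U = T"
proof -
  \<comment> \<open>Maximal dimension is enough, since nested subspaces of equal dimension coincide.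
    \<open>Suc dimension\<close> serves as a strict bound on all dimensions.\<close>
  obtain T where T: "P T" "A \<subseteq> T" "\<And>U. P U \<Longrightarrow> A \<subseteq> U \<Longrightarrow> dim U \<le> dim T"
    using ex_has_greatest_nat[of "\<lambda>T. P T \<and> A \<subseteq> T" A dim "Suc dimension"] P dim_subset_UNIV
    by (auto simp: less_Suc_eq_le)
  show thesis
  proof
    fix U assume "P U" "T \<subseteq> U"
    then show "U = T"
      using T sub subspace_dim_equal[of T U] by blast
  qed (use T in auto)
qed

text \<open>A maximal subspace among those of rank \<open>r A\<close> above \<open>A\<close> is a
  flat: a proper enlargement must change the rank, and by monotonicity it can only raise it.\<close>

lemma q_flat_closure_exists:
  assumes r: "q_matroid r" and A: "subspace A"
  obtains T where "q_flat r T" "A \<subseteq> T" "r T = r A"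
proof -
  obtain T where T: "subspace T \<and> r T = r A" "A \<subseteq> T"
    and max: "\<And>U. subspace U \<and> r U = r A \<Longrightarrow> T \<subseteq> U \<Longrightarrow> U = T"
    using maximal_subspace_exists[of "\<lambda>T. subspace T \<and> r T = r A" A] A by blast
  have "r T < r (subspace_sum T X)" if X: "subspace X" "\<not> X \<subseteq> T" for X
  proof -
    have sum: "subspace_sum T X = span (T \<union> X)"
      using T X by (simp add: subspace_sum_eq_span)
    have sup: "T \<union> X \<subseteq> span (T \<union> X)"
      by (rule span_superset)
    then have "r T \<le> r (span (T \<union> X))"
      using T by (intro q_matroid_rank_mono[OF r]) auto
    moreover have "r (span (T \<union> X)) \<noteq> r T"
      using max[of "span (T \<union> X)"] sup X T by auto
    ultimately show ?thesis
      using sum by simp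
  qed
  then have "q_flat r T"
    using T by (auto simp: q_flat_def)
  then show thesis
    using T that by blast
qed

text \<open>Passes from single vectors to whole subspaces without induction: a flat above
  \<open>A\<close> of the same rank contains each \<open>x\<close> in \<open>S\<close>, so
  \<open>r S\<close> is squeezed between \<open>r A\<close> and the rank of that flat.\<close>

lemma rank_eq_if_increments_trivial:
  assumes r: "q_matroid r" and S: "subspace S" and A: "subspace A" "A \<subseteq> S"
    and triv: "\<And>x. x \<in> S \<Longrightarrow> r (span (insert x A)) = r A"
  shows "r S = r A"
proof -
  obtain T where T: "q_flat r T" "A \<subseteq> T" "r T = r A"
    using q_flat_closure_exists[OF r A(1)] by blast
  have "S \<subseteq> T"
    using q_flat_mem[OF r T(1) A(1) T(2)] triv by blast
  then have "r S \<le> r T"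
    using S T(1) by (intro q_matroid_rank_mono[OF r]) (auto simp: q_flat_def)
  moreover have "r A \<le> r S"
    using A S by (intro q_matroid_rank_mono[OF r])
  ultimately show ?thesis
    using T(3) by simp
qed

section \<open>Independent subspaces and bases\<close>

text \<open>A complement of \<open>A\<close> in \<open>S\<close> contributes at most its dimension
  to the rank, so \<open>A\<close> must supply the remaining \<open>dim A\<close> of
  \<open>r S = dim S\<close>.\<close>

lemma q_independent_subset:
  assumes r: "q_matroid r" and S: "q_independent r S" and A: "subspace A" "A \<subseteq> S"
  shows "q_independent r A"
proof -
  have sS: "subspace S" and rS: "r S = int (dim S)"
    using S by (auto simp: q_independent_def)
  obtain b where b: "b \<subseteq> A" "independent b" "A \<subseteq> span b" "card b = dim A"
    using basis_exists by blast
  obtain c where c: "b \<subseteq> c" "c \<subseteq> S" "independent c" "S \<subseteq> span c"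
    using maximal_independent_subset_extend[of b S] b A by blast
  have fin: "finite c"
    using c(3) by (rule finiteI_independent)
  have cS: "card c = dim S"
    using c basis_card_eq_dim by blast
  \<comment> \<open>A complement of \<open>A\<close> in \<open>S\<close>, from a basis
    \<open>b\<close> of \<open>A\<close> extended to a basis \<open>c\<close> of
    \<open>S\<close>.\<close>
  let ?C = "span (c - b)"
  have "c \<subseteq> span (A \<union> ?C)"
    using b(1) span_superset[of "c - b"] span_superset[of "A \<union> ?C"] by blast
  then have "S \<subseteq> span (A \<union> ?C)"
    using c(4) span_minimal[of c "span (A \<union> ?C)"] by simp
  then have "r S \<le> r (span (A \<union> ?C))"
    using sS by (intro q_matroid_rank_mono[OF r]) auto
  also have "\<dots> \<le> r A + r ?C"
    using q_matroid_rank_submodular[OF r A(1), of ?C]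
      q_matroid_rank_nonneg[OF r, of "A \<inter> ?C"] A(1) by (simp add: subspace_inter)
  also have "r ?C \<le> int (dim ?C)"
    by (rule q_matroid_rank_le_dim[OF r]) simp
  also have "dim ?C \<le> card (c - b)"
    using fin by (simp add: dim_le_card')
  finally have "int (dim S) \<le> r A + int (card (c - b))"
    using rS by simp
  moreover have "card (c - b) = card c - card b" "card b \<le> card c"
    using c(1) fin by (auto simp: card_Diff_subset finite_subset card_mono)
  ultimately have "int (dim A) \<le> r A"
    using cS b(4) by simp
  then show ?thesis
    using q_matroid_rank_le_dim[OF r A(1)] A(1) by (simp add: q_independent_def)
qed

text \<open>The new rank is an integer between \<open>dim A\<close> and \<open>dim A + 1\<close>,
  and dependence excludes the upper value.\<close>

lemma rank_insert_if_dependent: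
  assumes r: "q_matroid r" and A: "q_independent r A" and x: "x \<notin> A"
    and dep: "\<not> q_independent r (span (insert x A))"
  shows "r (span (insert x A)) = r A"
proof -
  have sA: "subspace A" and rA: "r A = int (dim A)"
    using A by (auto simp: q_independent_def)
  have "x \<notin> span A"
    using x sA span_eq_iff by blast
  then have "dim (span (insert x A)) = dim A + 1"
    by (simp add: dim_insert)
  moreover have "r (span (insert x A)) \<noteq> int (dim (span (insert x A)))"
    using dep by (simp add: q_independent_def)
  moreover have "r (span (insert x A)) \<le> int (dim (span (insert x A)))"
    by (rule q_matroid_rank_le_dim[OF r]) simp
  moreover have "r A \<le> r (span (insert x A))"
    using span_superset[of "insert x A"] by (intro q_matroid_rank_mono[OF r]) (auto simp: sA)
  ultimately show ?thesis
    using rA by simp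
qed

text \<open>By maximality, adjoining any vector of \<open>S\<close> outside \<open>A\<close> gives a
  dependent subspace, hence no gain in rank; the absence of single gains then settles all of
  \<open>S\<close>. With \<open>S = UNIV\<close> this gives the rank of bases.\<close>

lemma maximal_independent_rank:
  assumes r: "q_matroid r" and S: "subspace S" and A: "q_independent r A" "A \<subseteq> S"
    and max: "\<And>U. q_independent r U \<Longrightarrow> U \<subseteq> S \<Longrightarrow> A \<subseteq> U \<Longrightarrow> U = A"
  shows "r S = r A"
proof (rule rank_eq_if_increments_trivial[OF r S])
  show sA: "subspace A"
    using A(1) by (rule q_independent_subspace)
  fix x assume xS: "x \<in> S"
  show "r (span (insert x A)) = r A"
  proof (cases "x \<in> A")
    case True
    then show ?thesis
      by (metis insert_absorb sA span_eq_iff)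
  next
    case False
    have "\<not> q_independent r (span (insert x A))"
    proof
      assume "q_independent r (span (insert x A))"
      moreover have "span (insert x A) \<subseteq> S"
        using xS A(2) S by (intro span_minimal) auto
      ultimately have "span (insert x A) = A"
        using max span_superset[of "insert x A"] by blast
      then show False
        using False span_superset[of "insert x A"] by blast
    qed
    then show ?thesis
      using rank_insert_if_dependent[OF r A(1) False] by blast
  qed
qed (rule A(2))

lemma independent_of_full_rank_exists:
  assumes r: "q_matroid r" and S: "subspace S"
  obtains A where "q_independent r A" "A \<subseteq> S" "r S = r A"
proof -
  let ?P = "\<lambda>A. q_independent r A \<and> A \<subseteq> S"
  \<comment> \<open>The zero subspace starts the search for a maximal independent subspace: its rank
    is squeezed between 0 and its dimension 0.\<close>
  have "q_independent r {0}"
    using q_matroid_rank_nonneg[OF r, of "{0}"] q_matroid_rank_le_dim[OF r, of "{0}"]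
    by (simp add: q_independent_def)
  then have P0: "?P {0}"
    using subspace_0[OF S] by simp
  obtain A where A: "?P A" and max: "\<And>U. ?P U \<Longrightarrow> A \<subseteq> U \<Longrightarrow> U = A"
    by (rule maximal_subspace_exists[of ?P, OF P0]) (auto dest: q_independent_subspace)
  have "r S = r A"
    using A max by (intro maximal_independent_rank[OF r S]) auto
  then show thesis
    using A by (intro that[of A]) auto
qed

lemma q_basis_rank: "q_matroid r \<Longrightarrow> q_basis r A \<Longrightarrow> r A = r UNIV"
  using maximal_independent_rank[of r UNIV A] by (simp add: q_basis_def)

lemma q_independent_extends_to_basis:
  assumes "q_independent r A"
  obtains B where "q_basis r B" "A \<subseteq> B"
  using maximal_subspace_exists[of "q_independent r" A] assms q_independent_subspace
  unfolding q_basis_def by metis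

text \<open>An independent \<open>U\<close> above \<open>A\<close> has dimension \<open>r U\<close>,
  which is at most \<open>r UNIV = dim A\<close>.\<close>

lemma q_basis_if_full_rank:
  assumes r: "q_matroid r" and A: "q_independent r A" and full: "r A = r UNIV"
  shows "q_basis r A"
  unfolding q_basis_def
proof (intro conjI allI impI A)
  fix U assume U: "q_independent r U" "A \<subseteq> U"
  have "r U \<le> r UNIV"
    using U(1) by (intro q_matroid_rank_mono[OF r]) (auto simp: q_independent_def)
  then have "dim U \<le> dim A"
    using U(1) A full by (simp add: q_independent_def)
  then show "U = A"
    using U A subspace_dim_equal[of A U] by (auto simp: q_independent_def)
qed

lemma q_spanning_contains_basis:
  assumes r: "q_matroid r" and S: "q_spanning r S"
  obtains A where "q_basis r A" "A \<subseteq> S"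
proof -
  have sS: "subspace S"
    using S by (simp add: q_spanning_def)
  obtain A where A: "q_independent r A" "A \<subseteq> S" "r S = r A"
    by (rule independent_of_full_rank_exists[OF r sS])
  then have "q_basis r A"
    using S by (intro q_basis_if_full_rank[OF r]) (auto simp: q_spanning_def)
  then show thesis
    using A(2) by (rule that)
qed

section \<open>Consequences of a strong map\<close>

text \<open>A flat of \<open>r2\<close> above \<open>A\<close> with rank \<open>r2 A\<close> is also
  a flat of \<open>r1\<close>, so it captures every \<open>x\<close> that leaves \<open>r1 A\<close>
  unchanged; then \<open>x\<close> cannot raise \<open>r2 A\<close> either.\<close>

lemma id_strong_map_rank_insert:
  assumes r1: "q_matroid r1" and r2: "q_matroid r2" and strong: "id_strong_map r1 r2"
    and A: "subspace A" and x: "r1 (span (insert x A)) = r1 A"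
  shows "r2 (span (insert x A)) = r2 A"
proof -
  obtain T where T: "q_flat r2 T" "A \<subseteq> T" "r2 T = r2 A"
    using q_flat_closure_exists[OF r2 A] by blast
  have sT: "subspace T" and T1: "q_flat r1 T"
    using T(1) strong by (auto simp: q_flat_def id_strong_map_def)
  have "x \<in> T"
    by (rule q_flat_mem[OF r1 T1 A T(2) x])
  then have "span (insert x A) \<subseteq> T"
    using T(2) sT by (intro span_minimal) auto
  then have "r2 (span (insert x A)) \<le> r2 T"
    using sT by (intro q_matroid_rank_mono[OF r2]) auto
  moreover have "r2 A \<le> r2 (span (insert x A))"
    using A span_superset[of "insert x A"] by (intro q_matroid_rank_mono[OF r2]) auto
  ultimately show ?thesis
    using T(3) by simp
qed

text \<open>An \<open>r1\<close>-independent \<open>A\<close> inside \<open>S\<close> of full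
  \<open>r1\<close>-rank admits no \<open>r1\<close>-gain within \<open>S\<close>, hence no
  \<open>r2\<close>-gain. So \<open>dim S = r2 S = r2 A \<le> dim A\<close>, which forces
  \<open>A = S\<close>.\<close>

lemma id_strong_map_independent:
  assumes r1: "q_matroid r1" and r2: "q_matroid r2" and strong: "id_strong_map r1 r2"
    and S: "q_independent r2 S"
  shows "q_independent r1 S"
proof -
  have sS: "subspace S"
    using S by (rule q_independent_subspace)
  obtain A where A: "q_independent r1 A" "A \<subseteq> S" and rank: "r1 S = r1 A"
    by (rule independent_of_full_rank_exists[OF r1 sS])
  have sA: "subspace A"
    using A(1) by (rule q_independent_subspace)
  have "r2 S = r2 A"
  proof (rule rank_eq_if_increments_trivial[OF r2 sS sA])
    fix x assume "x \<in> S"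
    then have "span (insert x A) \<subseteq> S"
      using A sS by (intro span_minimal) auto
    then have "r1 (span (insert x A)) \<le> r1 S"
      using sS by (intro q_matroid_rank_mono[OF r1]) auto
    moreover have "r1 A \<le> r1 (span (insert x A))"
      using sA span_superset[of "insert x A"] by (intro q_matroid_rank_mono[OF r1]) auto
    ultimately have "r1 (span (insert x A)) = r1 A"
      using rank by simp
    then show "r2 (span (insert x A)) = r2 A"
      by (rule id_strong_map_rank_insert[OF r1 r2 strong sA])
  qed (rule A(2))
  then have "dim S \<le> dim A"
    using S q_matroid_rank_le_dim[OF r2 sA] by (simp add: q_independent_def)
  then have "A = S"
    using subspace_dim_equal[OF sA sS] A by blast
  then show ?thesis
    using A by blast
qed

text \<open>No vector raises the \<open>r1\<close>-rank of an \<open>r1\<close>-spanning subspace,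
  so none raises its \<open>r2\<close>-rank, and that rank is already full.\<close>

lemma id_strong_map_spanning:
  assumes r1: "q_matroid r1" and r2: "q_matroid r2" and strong: "id_strong_map r1 r2"
    and S: "q_spanning r1 S"
  shows "q_spanning r2 S"
proof -
  have sS: "subspace S" and rS: "r1 S = r1 UNIV"
    using S by (auto simp: q_spanning_def)
  have "r2 UNIV = r2 S"
  proof (rule rank_eq_if_increments_trivial[OF r2 _ sS])
    fix x
    have "r1 S \<le> r1 (span (insert x S))"
      using sS span_superset[of "insert x S"] by (intro q_matroid_rank_mono[OF r1]) auto
    moreover have "r1 (span (insert x S)) \<le> r1 UNIV"
      by (intro q_matroid_rank_mono[OF r1]) auto
    ultimately have "r1 (span (insert x S)) = r1 S"
      using rS by simp
    then show "r2 (span (insert x S)) = r2 S"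
      by (rule id_strong_map_rank_insert[OF r1 r2 strong sS])
  qed auto
  then show ?thesis
    using sS by (simp add: q_spanning_def)
qed

section \<open>Comparison of the two families\<close>

lemma q_g_matroid_imp_weak:
  assumes "q_g_matroid \<F>"
  shows "weak_q_g_matroid \<F>"
proof -
  obtain r1 r2 where r1: "q_matroid r1" and r2: "q_matroid r2" and strong: "id_strong_map r1 r2"
    and F: "\<F> = {F. q_independent r1 F \<and> q_spanning r2 F}"
    using assms by (auto simp: q_g_matroid_def)
  have basis2: "\<exists>B1. q_basis r1 B1 \<and> B2 \<subseteq> B1" if "q_basis r2 B2" for B2
    using id_strong_map_independent[OF r1 r2 strong] q_basis_independent[OF that]
      q_independent_extends_to_basis by metis
  have basis1: "\<exists>B2. q_basis r2 B2 \<and> B2 \<subseteq> B1" if B1: "q_basis r1 B1" for B1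
  proof -
    have "q_spanning r1 B1"
      using q_basis_rank[OF r1 B1] q_independent_subspace[OF q_basis_independent[OF B1]]
      by (simp add: q_spanning_def)
    then show ?thesis
      using id_strong_map_spanning[OF r1 r2 strong] q_spanning_contains_basis[OF r2] by metis
  qed
  \<comment> \<open>Forward, \<open>F\<close> extends to an \<open>r1\<close>-basis and contains an
    \<open>r2\<close>-basis. Backward, independence passes down from \<open>B1\<close>, and
    \<open>r2 F\<close> lies between \<open>r2 B2 = r2 UNIV\<close> and
    \<open>r2 UNIV\<close>.\<close>
  have between: "q_independent r1 F \<and> q_spanning r2 F \<longleftrightarrow>
      subspace F \<and> (\<exists>B2 B1. q_basis r2 B2 \<and> q_basis r1 B1 \<and> B2 \<subseteq> F \<and> F \<subseteq> B1)" for F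
  proof
    assume "q_independent r1 F \<and> q_spanning r2 F"
    then show "subspace F \<and> (\<exists>B2 B1. q_basis r2 B2 \<and> q_basis r1 B1 \<and> B2 \<subseteq> F \<and> F \<subseteq> B1)"
      using q_independent_extends_to_basis[of r1 F] q_spanning_contains_basis[OF r2, of F]
        q_independent_subspace by metis
  next
    assume "subspace F \<and> (\<exists>B2 B1. q_basis r2 B2 \<and> q_basis r1 B1 \<and> B2 \<subseteq> F \<and> F \<subseteq> B1)"
    then obtain B2 B1 where sF: "subspace F" and B: "q_basis r2 B2" "q_basis r1 B1"
      and sub: "B2 \<subseteq> F" "F \<subseteq> B1"
      by blast
    have "q_independent r1 F"
      using q_independent_subset[OF r1 q_basis_independent[OF B(2)] sF sub(2)] .
    moreover have "r2 B2 \<le> r2 F"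
      using sub(1) sF q_independent_subspace[OF q_basis_independent[OF B(1)]]
      by (intro q_matroid_rank_mono[OF r2])
    moreover have "r2 F \<le> r2 UNIV"
      using sF by (intro q_matroid_rank_mono[OF r2]) auto
    ultimately show "q_independent r1 F \<and> q_spanning r2 F"
      using q_basis_rank[OF r2 B(1)] sF by (simp add: q_spanning_def)
  qed
  show ?thesis
    unfolding weak_q_g_matroid_def
    using r1 r2 basis1 basis2 F between by (intro exI[of _ r1] exI[of _ r2]) simp
qed

end

theorem proposition4p4:
  fixes scale :: "'a::field \<Rightarrow> 'v::ab_group_add \<Rightarrow> 'v"
    and B :: "'v set"
    and \<F> :: "'v set set"
  assumes "finite_dimensional_vector_space scale B"
    and "vector_space.q_g_matroid scale \<F>"
  shows "vector_space.weak_q_g_matroid scale \<F>"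
  using assms by (rule finite_dimensional_vector_space.q_g_matroid_imp_weak)

end
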